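(* Let $p$ be an odd prime and let $$\Omega'_{K,p}=\{x+x^{-1}: 1\le x,x^{-1}\le p-1 \text{ and } x+_{\mathbb Z}x^{-1}<p\}.$$ Then for every positive integer $h<p/2$, $$\frac1p\sum_{n=0}^{p-1}\Bigg(\sum_{\substack{m\in[n,n+h]\\ m\in\Omega'_{K,p}}}1-\frac hp\,|\Omega'_{K,p}|\Bigg)^{2}\gg h^2,$$ with an absolute implied constant.
   Context: For $x\in\{1,\dots,p-1\}$, $x^{-1}\in\{1,\dots,p-1\}$ denotes the integer representing the inverse of $x$ modulo $p$, and $+_{\mathbb Z}$ denotes addition in $\mathbb Z$ (not modulo $p$). $\Omega'_{K,p}$ is regarded as a subset of $\mathbb Z/p\mathbb Z$ (without multiplicity), and the condition $m\in\Omega'_{K,p}$ for an integer $m\in[n,n+h]$ is understood modulo $p$. $f\gg g$ means $f\ge cg$ for some constant $c>0$. *)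

theory Defs
  imports Complex_Main "HOL-Number_Theory.Number_Theory"
begin

text \<open>
  For a prime \<open>p\<close> and \<open>1 \<le> x \<le> p - 1\<close>, \<open>modular_inverse p x\<close> is the integer in \<open>{1..p - 1}\<close>
  that inverts \<open>x\<close> modulo \<open>p\<close>. A subset of \<open>\<int>/p\<int>\<close> is given by its representatives
  in \<open>{0..p - 1}\<close>. No reduction modulo \<open>p\<close> is needed in the definition below: \<open>+\<close> is addition
  in \<open>\<int>\<close> and the sum is less than \<open>p\<close>, so it is its own representative. For an arbitrary
  integer \<open>m\<close>, membership modulo \<open>p\<close> is \<open>m mod p \<in> Omega_K' p\<close>.
\<close>

definition Omega_K' :: "int \<Rightarrow> int set" where
  "Omega_K' p =
     {x + modular_inverse p x | x.
        x \<in> {1..p - 1} \<and> modular_inverse p x \<in> {1..p - 1} \<and> x + modular_inverse p x < p}"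

end

theory Submission
  imports Defs "HOL-Analysis.Analysis" "HOL-Real_Asymp.Real_Asymp"
begin

text \<open>
  Write \<open>e(t) = exp (2 \<pi> i t / p)\<close>. By Cauchy--Schwarz against \<open>e(-n)\<close>, the variance is at
  least \<open>\<bar>\<Sum>j\<le>h. e(j)\<bar>\<^sup>2 \<bar>\<Sum>w\<in>\<Omega>'. e(w)\<bar>\<^sup>2 / p\<^sup>2\<close>, and the first factor is \<open>\<gg> h\<^sup>2\<close>, so it
  suffices that the first Fourier coefficient of \<open>\<Omega>'\<close> is \<open>\<gg> p\<close>. The indicator of
  \<open>x + x\<inverse> \<ge> p\<close> is \<open>(x + x\<inverse> - ((x + x\<inverse>) mod p)) / p\<close>; expanding each sawtooth \<open>(y mod p) / p\<close>
  into its finite Fourier series turns the coefficient into Kloosterman sums. The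
  frequency \<open>-1\<close> of the last sawtooth contributes a main term of size about \<open>p / (2 \<pi>)\<close>, and
  all other Kloosterman sums are \<open>O(p\<^bsup>3/4\<^esup>)\<close> by Kloosterman's fourth moment argument, while
  the Fourier coefficients of the sawtooth have absolute sum \<open>O(ln p)\<close>. For bounded \<open>p\<close>,
  Cauchy--Schwarz against the constant \<open>1\<close> suffices: the interval \<open>[n, n + h]\<close> has \<open>h + 1\<close> elements,
  so the deviations sum to \<open>\<bar>\<Omega>'\<bar> \<ge> 1\<close>.
\<close>

section \<open>Elementary estimates and sums\<close>

lemma sin_ge_quarter:
  fixes x :: real
  assumes "0 \<le> x" "x \<le> 2 * pi / 3"
  shows "x / 4 \<le> sin x"
proof -
  obtain t where "sin x = (\<Sum>m<3. sin_coeff m * x ^ m) + (sin (t + 1/2 * real 3 * pi) / fact 3) * x ^ 3"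
    using Maclaurin_sin_expansion by blast
  then have "sin x = x + sin (t + 1/2 * real 3 * pi) * x ^ 3 / 6"
    by (simp add: sin_coeff_def numeral_eq_Suc)
  moreover have "sin (t + 1/2 * real 3 * pi) * x ^ 3 \<ge> (-1) * x ^ 3"
    using assms by (intro mult_right_mono) auto
  ultimately have "sin x \<ge> x - x ^ 3 / 6"
    by simp
  \<comment> \<open>x - x^3/6 - x/4 equals (x/6) (9/2 - x^2), so it suffices that x^2 <= 9/2; this
    holds since 2 pi / 3 < 2.12.\<close>
  moreover have "x * (9 / 2 - x\<^sup>2) \<ge> 0"
  proof -
    have "x \<le> 2.12"
      using assms pi_less_4 pi_approx by simp
    then have "x\<^sup>2 \<le> 2.12\<^sup>2"
      using assms by (intro power_mono) auto
    also have "\<dots> \<le> (9 / 2 :: real)"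
      by (simp add: power2_eq_square)
    finally show ?thesis
      using assms by simp
  qed
  ultimately show ?thesis
    by (simp add: algebra_simps power2_eq_square power3_eq_cube)
qed

text \<open>Summation by parts: multiplying by z - 1 leaves a boundary term and a geometric sum, and
  the latter vanishes at n. With z = \<open>ep (- k)\<close> this evaluates the Fourier coefficients
  of the sawtooth.\<close>

lemma sum_mult_power_root_of_unity:
  fixes z :: "'a :: field"
  assumes "z ^ n = 1" "z \<noteq> 1"
  shows "(\<Sum>y<n. of_nat y * z ^ y) = of_nat n / (z - 1)"
proof -
  have "(z - 1) * (\<Sum>y<m. of_nat y * z ^ y) = of_nat m * z ^ m - z * (\<Sum>y<m. z ^ y)" for m
    by (induction m) (auto simp: algebra_simps)
  then have "(z - 1) * (\<Sum>y<n. of_nat y * z ^ y) = of_nat n * z ^ n - z * ((z ^ n - 1) / (z - 1))"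
    using assms by (simp add: geometric_sum)
  then show ?thesis
    using assms by (simp add: field_simps)
qed

lemma sum_int_atLeast0LessThan:
  assumes "0 \<le> (p::int)"
  shows "(\<Sum>n\<in>{0..<p}. g n) = (\<Sum>i<nat p. g (int i))"
  by (rule sum.reindex_bij_witness[of _ int nat]) (use assms in auto)

section \<open>Additive characters modulo p\<close>

locale modulus =
  fixes p :: int
  assumes p_gt_1: "p > 1"
begin

definition ep :: "int \<Rightarrow> complex" where
  "ep t = cis (2 * pi * of_int t / of_int p)"

lemma ep_0 [simp]: "ep 0 = 1"
  by (simp add: ep_def)

lemma ep_add: "ep (s + t) = ep s * ep t"
  by (simp add: ep_def cis_mult add_divide_distrib ring_distribs)

lemma ep_minus: "ep (- t) = cnj (ep t)"
  by (simp add: ep_def cis_cnj)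

lemma ep_diff: "ep (s - t) = ep s * cnj (ep t)"
  using ep_add[of s "- t"] by (simp add: ep_minus)

lemma norm_ep [simp]: "cmod (ep t) = 1"
  by (simp add: ep_def)

lemma ep_multiple [simp]: "ep (p * k) = 1"
  using p_gt_1 cis_multiple_2pi[of "of_int k"] by (simp add: ep_def mult.assoc)

lemma ep_cong: "[s = t] (mod p) \<Longrightarrow> ep s = ep t"
proof -
  assume "[s = t] (mod p)"
  then obtain k where "s = t + p * k"
    by (metis cong_iff_lin cong_sym)
  then show ?thesis
    by (simp add: ep_add)
qed

lemma ep_mod: "ep (k * (t mod p)) = ep (k * t)"
  by (intro ep_cong cong_mult) auto

lemma ep_power: "ep (k * int n) = ep k ^ n"
  by (induction n) (simp_all add: ring_distribs ep_add)

lemma norm_ep_minus_1: "cmod (ep k - 1) = 2 * \<bar>sin (pi * of_int k / of_int p)\<bar>"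
  using dist_exp_i_1[of "2 * pi * of_int k / of_int p"] by (simp add: ep_def cis_conv_exp)

lemma norm_ep_minus_1_le: "cmod (ep 1 - 1) \<le> 2 * pi / of_int p"
  unfolding norm_ep_minus_1 using p_gt_1 abs_sin_x_le_abs_x[of "pi * of_int 1 / of_int p"] by simp

text \<open>The range goes beyond p/2 because the intervals have h + 1 points with 2h < p: for p =
  3, h = 1 the ratio (h + 1)/p is exactly 2/3. The constant comes from 2 sin x >= x/2 at x = pi k /
  p, together with pi >= 2.\<close>

lemma norm_ep_minus_1_ge:
  assumes "0 \<le> k" "3 * k \<le> 2 * p"
  shows "cmod (ep k - 1) \<ge> of_int k / of_int p"
proof -
  have "3 * real_of_int k \<le> 2 * of_int p"
    using assms(2) by linarith
  then have "pi * (3 * real_of_int k) \<le> pi * (2 * of_int p)"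
    by (intro mult_left_mono) auto
  then have "pi * of_int k / of_int p / 4 \<le> sin (pi * of_int k / of_int p)"
    using assms p_gt_1 by (intro sin_ge_quarter) (auto simp: field_simps)
  moreover have "2 * (real_of_int k / of_int p) \<le> pi * (of_int k / of_int p)"
    using assms p_gt_1 pi_ge_two by (intro mult_right_mono) auto
  ultimately show ?thesis
    unfolding norm_ep_minus_1 by simp
qed

lemma norm_ep_minus_1_ge':
  assumes "0 \<le> k" "k \<le> p"
  shows "cmod (ep k - 1) \<ge> of_int (min k (p - k)) / of_int p"
proof (cases "2 * k \<le> p")
  case True
  then show ?thesis
    using norm_ep_minus_1_ge[of k] assms by auto
next
  case False
  have "cmod (ep (p - k) - 1) = cmod (ep k - 1)"
    using ep_multiple[of 1] complex_mod_cnj[of "ep k - 1"] by (simp add: ep_diff)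
  then show ?thesis
    using norm_ep_minus_1_ge[of "p - k"] assms False by auto
qed

lemma ep_neq_1:
  assumes "\<not> p dvd k"
  shows "ep k \<noteq> 1"
proof -
  have "k mod p > 0" "k mod p < p"
    using assms p_gt_1 by (simp_all add: dvd_eq_mod_eq_0 order_less_le[of 0])
  then have "0 < real_of_int (min (k mod p) (p - k mod p)) / of_int p"
    using p_gt_1 by auto
  also have "\<dots> \<le> cmod (ep (k mod p) - 1)"
    using p_gt_1 by (intro norm_ep_minus_1_ge') (auto intro: less_imp_le)
  also have "ep (k mod p) = ep k"
    by (intro ep_cong) auto
  finally show ?thesis
    by auto
qed

lemma sum_ep: "(\<Sum>n\<in>{0..<p}. ep (k * n)) = (if p dvd k then of_int p else 0)"
proof (cases "p dvd k")
  case True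
  then have "ep (k * n) = 1" for n
    by (metis dvdE ep_multiple mult.assoc)
  then show ?thesis
    using True p_gt_1 by simp
next
  case False
  have "ep k ^ nat p = 1"
    using ep_power[of k "nat p"] p_gt_1 by (simp add: mult.commute[of k])
  then show ?thesis
    using False ep_neq_1[OF False] p_gt_1
    by (simp add: sum_int_atLeast0LessThan ep_power geometric_sum)
qed

lemma bij_betw_shift_mod: "bij_betw (\<lambda>n. (n + j) mod p) {0..<p} {0..<p}"
proof (rule bij_betwI[of _ _ _ "\<lambda>n. (n - j) mod p"])
  show "((x + j) mod p - j) mod p = x" "((x - j) mod p + j) mod p = x" if "x \<in> {0..<p}" for x
    using that by (simp_all add: mod_simps)
qed (use p_gt_1 in auto)

text \<open>In the geometric series the chord \<open>ep m - 1\<close> has length at least m/p, while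
  \<open>ep 1 - 1\<close> has length at most 2 pi / p. So there is almost no cancellation at
  frequency 1.\<close>

lemma norm_sum_ep:
  assumes "0 \<le> m" "3 * m \<le> 2 * p"
  shows "cmod (\<Sum>j\<in>{0..<m}. ep j) \<ge> of_int m / (2 * pi)"
proof -
  have "(\<Sum>j\<in>{0..<m}. ep j) = (ep m - 1) / (ep 1 - 1)"
  proof -
    have "\<not> p dvd 1"
      using p_gt_1 by (simp add: zdvd_not_zless)
    then show ?thesis
      using ep_power[of 1] ep_power[of 1 "nat m"] ep_neq_1[of 1] assms
      by (simp add: sum_int_atLeast0LessThan geometric_sum)
  qed
  moreover have "of_int m / of_int p / (2 * pi / of_int p) \<le> cmod (ep m - 1) / cmod (ep 1 - 1)"
    using norm_ep_minus_1_ge[OF assms] norm_ep_minus_1_le norm_ep_minus_1_ge'[of 1] p_gt_1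
    by (intro frac_le) (auto simp: min_def)
  ultimately show ?thesis
    using p_gt_1 by (simp add: norm_divide)
qed

section \<open>Finite Fourier series of the sawtooth y / p on the residues 0, ..., p - 1\<close>

definition fcoeff :: "int \<Rightarrow> complex" where
  "fcoeff k = (\<Sum>y\<in>{0..<p}. of_int y / of_int p * ep (- (k * y))) / of_int p"

lemma fourier_inversion:
  assumes "x \<in> {0..<p}"
  shows "(\<Sum>k\<in>{0..<p}. fcoeff k * ep (k * x)) = of_int x / of_int p"
proof -
  have "(\<Sum>k\<in>{0..<p}. fcoeff k * ep (k * x)) =
      (\<Sum>k\<in>{0..<p}. \<Sum>y\<in>{0..<p}. of_int y / of_int p * ep ((x - y) * k) / of_int p)"
    by (simp add: fcoeff_def sum_divide_distrib sum_distrib_right sum_distrib_left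
        ep_diff ep_minus algebra_simps)
  also have "\<dots> = (\<Sum>y\<in>{0..<p}. of_int y / of_int p * (\<Sum>k\<in>{0..<p}. ep ((x - y) * k)) / of_int p)"
    by (subst sum.swap) (simp add: sum_divide_distrib sum_distrib_left)
  also have "\<dots> = (\<Sum>y\<in>{0..<p}. if y = x then of_int x / of_int p else 0)"
  proof (rule sum.cong)
    fix y assume y: "y \<in> {0..<p}"
    then have "p dvd x - y \<longleftrightarrow> y = x"
      using assms by (auto simp: mod_eq_dvd_iff[symmetric])
    then show "of_int y / of_int p * (\<Sum>k\<in>{0..<p}. ep ((x - y) * k)) / of_int p =
        (if y = x then of_int x / of_int p else 0)"
      using p_gt_1 by (simp add: sum_ep)
  qed simp
  also have "\<dots> = of_int x / of_int p"
    using assms by simp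
  finally show ?thesis .
qed

lemma norm_fcoeff:
  assumes "\<not> p dvd k"
  shows "cmod (fcoeff k) = 1 / (of_int p * cmod (ep k - 1))"
proof -
  have k: "\<not> p dvd - k"
    using assms by simp
  have "ep (- k) ^ nat p = 1"
    using ep_power[of "- k" "nat p"] ep_multiple[of "- k"] p_gt_1 by (simp add: mult.commute[of k])
  then have "(\<Sum>y<nat p. of_nat y * ep (- k) ^ y) = of_nat (nat p) / (ep (- k) - 1)"
    using ep_neq_1[OF k] by (intro sum_mult_power_root_of_unity) auto
  moreover have "fcoeff k = (\<Sum>y<nat p. of_nat y * ep (- k) ^ y) / (of_int p * of_int p)"
    using p_gt_1 ep_power[of "- k"]
    by (simp add: fcoeff_def sum_int_atLeast0LessThan sum_divide_distrib)
  ultimately have "fcoeff k = 1 / (of_int p * cnj (ep k - 1))"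
    using p_gt_1 by (simp add: ep_minus)
  then show ?thesis
    using p_gt_1 by (simp add: norm_divide norm_mult del: complex_cnj_diff)
qed

lemma norm_fcoeff_0: "cmod (fcoeff 0) \<le> 1"
proof -
  have "cmod (\<Sum>y\<in>{0..<p}. of_int y / of_int p * ep (- (0 * y))) \<le> (\<Sum>y\<in>{0..<p}. 1)"
    by (intro sum_norm_le) (auto simp: norm_divide)
  then show ?thesis
    using p_gt_1 by (simp add: fcoeff_def norm_divide)
qed

text \<open>The reciprocal of the distance from k to the nearest multiple of p is relaxed to a sum
  of two reciprocals, so that summing over k gives two harmonic sums.\<close>

lemma norm_fcoeff_le:
  assumes "k \<in> {1..<p}"
  shows "cmod (fcoeff k) \<le> 1 / of_int k + 1 / of_int (p - k)"
proof -
  have "\<not> p dvd k"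
    using assms by (simp add: zdvd_not_zless)
  have "of_int p * (of_int (min k (p - k)) / of_int p) \<le> of_int p * cmod (ep k - 1)"
    using norm_ep_minus_1_ge'[of k] assms p_gt_1 by (intro mult_left_mono) auto
  then have "1 / (of_int p * cmod (ep k - 1)) \<le> 1 / of_int (min k (p - k))"
    using assms p_gt_1 by (intro frac_le) auto
  also have "\<dots> \<le> 1 / of_int k + 1 / of_int (p - k)"
    using assms by (auto simp: min_def)
  finally show ?thesis
    using norm_fcoeff[OF \<open>\<not> p dvd k\<close>] by simp
qed

text \<open>Frequency p - 1 is -1 modulo p and carries the main term. Its coefficient stays bounded
  below because the chord from 1 to \<open>ep 1\<close> is no longer than its arc 2 pi / p.\<close>

lemma norm_fcoeff_last: "cmod (fcoeff (p - 1)) \<ge> 1 / (2 * pi)"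
proof -
  have "\<not> p dvd p - 1"
    using p_gt_1 by (simp add: zdvd_not_zless)
  moreover have "cmod (ep (p - 1) - 1) = cmod (ep 1 - 1)"
    using ep_multiple[of 1] complex_mod_cnj[of "ep 1 - 1"] by (simp add: ep_diff)
  moreover have "1 / (2 * pi) \<le> 1 / (of_int p * cmod (ep 1 - 1))"
  proof (rule frac_le)
    have "0 < 1 / real_of_int p"
      using p_gt_1 by simp
    then show "0 < of_int p * cmod (ep 1 - 1)"
      using norm_ep_minus_1_ge'[of 1] p_gt_1 by (intro mult_pos_pos) (auto simp: min_def)
    show "of_int p * cmod (ep 1 - 1) \<le> 2 * pi"
      using norm_ep_minus_1_le p_gt_1 by (simp add: field_simps)
  qed auto
  ultimately show ?thesis
    by (simp add: norm_fcoeff)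
qed

lemma sum_norm_fcoeff: "(\<Sum>k\<in>{0..<p}. cmod (fcoeff k)) \<le> 3 + 2 * ln (of_int p)"
proof -
  have "{0..<p} = insert 0 {1..<p}"
    using p_gt_1 by auto
  then have "(\<Sum>k\<in>{0..<p}. cmod (fcoeff k)) = cmod (fcoeff 0) + (\<Sum>k\<in>{1..<p}. cmod (fcoeff k))"
    by simp
  also have "\<dots> \<le> 1 + (\<Sum>k\<in>{1..<p}. 1 / of_int k + 1 / of_int (p - k))"
    using norm_fcoeff_0 norm_fcoeff_le by (intro add_mono sum_mono) auto
  also have "(\<Sum>k\<in>{1..<p}. 1 / real_of_int (p - k)) = (\<Sum>k\<in>{1..<p}. 1 / of_int k)"
    by (rule sum.reindex_bij_witness[of _ "\<lambda>k. p - k" "\<lambda>k. p - k"]) auto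
  then have "(\<Sum>k\<in>{1..<p}. 1 / of_int k + 1 / real_of_int (p - k)) = 2 * (\<Sum>k\<in>{1..<p}. 1 / of_int k)"
    by (simp add: sum.distrib)
  also have "(\<Sum>k\<in>{1..<p}. 1 / real_of_int k) = harm (nat (p - 1))"
    unfolding harm_def
    by (rule sum.reindex_bij_witness[of _ int nat]) (auto simp: field_simps)
  \<comment> \<open>\<open>harm n - ln n\<close> decreases in n and equals 1 at n = 1.\<close>
  also have "harm (nat (p - 1)) \<le> 1 + ln (of_int (p - 1) :: real)"
    using euler_mascheroni_sequence_decreasing[of 1 "nat (p - 1)"] p_gt_1
    by (simp add: harm_expand Suc_le_eq)
  also have "ln (of_int (p - 1) :: real) \<le> ln (of_int p)"
    using p_gt_1 by simp
  finally show ?thesis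
    by simp
qed

text \<open>Opening the square and summing over both frequencies, orthogonality keeps exactly the
  pairs of points of A at which \<alpha> and \<beta> agree modulo p. This converts moments of
  exponential sums into counts of solutions of congruences.\<close>

lemma parseval:
  fixes \<alpha> \<beta> :: "'a \<Rightarrow> int"
  assumes A: "finite A"
  shows "(\<Sum>u\<in>{0..<p}. \<Sum>v\<in>{0..<p}. (cmod (\<Sum>t\<in>A. ep (u * \<alpha> t + v * \<beta> t)))\<^sup>2) =
    of_int p ^ 2 * of_nat (card {z \<in> A \<times> A. p dvd \<alpha> (fst z) - \<alpha> (snd z) \<and> p dvd \<beta> (fst z) - \<beta> (snd z)})"
proof -
  let ?R = "{0..<p}"
  define a where "a z = \<alpha> (fst z) - \<alpha> (snd z)" for z
  define b where "b z = \<beta> (fst z) - \<beta> (snd z)" for z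
  have "complex_of_real ((cmod (\<Sum>t\<in>A. ep (u * \<alpha> t + v * \<beta> t)))\<^sup>2) =
      (\<Sum>z\<in>A \<times> A. ep (a z * u) * ep (b z * v))" for u v
  proof -
    have "complex_of_real ((cmod (\<Sum>t\<in>A. ep (u * \<alpha> t + v * \<beta> t)))\<^sup>2) =
        (\<Sum>s\<in>A. \<Sum>t\<in>A. ep (u * \<alpha> s + v * \<beta> s) * cnj (ep (u * \<alpha> t + v * \<beta> t)))"
      unfolding complex_norm_square by (simp add: sum_product)
    also have "\<dots> = (\<Sum>z\<in>A \<times> A. ep (a z * u) * ep (b z * v))"
      unfolding sum.cartesian_product
      by (intro sum.cong) (auto simp: a_def b_def ep_diff[symmetric] ep_add[symmetric] algebra_simps)
    finally show ?thesis .
  qed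
  then have "complex_of_real (\<Sum>u\<in>?R. \<Sum>v\<in>?R. (cmod (\<Sum>t\<in>A. ep (u * \<alpha> t + v * \<beta> t)))\<^sup>2) =
      (\<Sum>u\<in>?R. \<Sum>v\<in>?R. \<Sum>z\<in>A \<times> A. ep (a z * u) * ep (b z * v))"
    by simp
  also have "\<dots> = (\<Sum>u\<in>?R. \<Sum>z\<in>A \<times> A. \<Sum>v\<in>?R. ep (a z * u) * ep (b z * v))"
    by (intro sum.cong refl sum.swap)
  also have "\<dots> = (\<Sum>z\<in>A \<times> A. \<Sum>u\<in>?R. \<Sum>v\<in>?R. ep (a z * u) * ep (b z * v))"
    by (rule sum.swap)
  also have "\<dots> = (\<Sum>z\<in>A \<times> A. (\<Sum>u\<in>?R. ep (a z * u)) * (\<Sum>v\<in>?R. ep (b z * v)))"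
    by (simp add: sum_product)
  also have "\<dots> = (\<Sum>z\<in>A \<times> A. if p dvd a z \<and> p dvd b z then of_int p ^ 2 else 0)"
    by (intro sum.cong) (auto simp: sum_ep power2_eq_square)
  also have "\<dots> = of_nat (card {z \<in> A \<times> A. p dvd a z \<and> p dvd b z}) * of_int p ^ 2"
    using A by (simp add: sum.inter_filter[symmetric])
  also have "\<dots> = complex_of_real (of_int p ^ 2 * of_nat (card {z \<in> A \<times> A. p dvd a z \<and> p dvd b z}))"
    by simp
  finally show ?thesis
    unfolding of_real_eq_iff a_def b_def .
qed

end

section \<open>Inversion modulo an odd prime and Kloosterman sums\<close>

locale odd_prime_modulus = modulus +
  assumes prime_p: "prime p" and odd_p: "odd p"
begin

lemma p_gt_2: "p > 2"
  using p_gt_1 odd_p by (cases "p = 2") auto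

abbreviation U :: "int set" where
  "U \<equiv> {1..<p}"

abbreviation I :: "int \<Rightarrow> int" where
  "I \<equiv> modular_inverse p"

lemma not_dvd_U: "x \<in> U \<Longrightarrow> \<not> p dvd x"
  by (simp add: zdvd_not_zless)

lemma coprime_U: "x \<in> U \<Longrightarrow> coprime x p"
  using not_dvd_U prime_p by (simp add: coprime_commute prime_imp_coprime)

lemma inv_mem [simp]: "x \<in> U \<Longrightarrow> I x \<in> U"
  using coprime_U mult_modular_inverse_int_pos[of p x] modular_inverse_int_less[of p x] p_gt_1
  by fastforce

lemma inv_cong: "x \<in> U \<Longrightarrow> [x * I x = 1] (mod p)"
  using coprime_U cong_modular_inverse1 by blast

lemma inv_inv [simp]: "x \<in> U \<Longrightarrow> I (I x) = x"
  using inv_cong[of x] by (intro modular_inverse_int_eqI) (auto simp: mult.commute)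

lemma U_eqI: "x \<in> U \<Longrightarrow> y \<in> U \<Longrightarrow> p dvd x - y \<Longrightarrow> x = y"
  by (metis atLeastLessThan_iff mod_eq_dvd_iff mod_pos_pos_trivial order_trans zero_le_one)

definition kloosterman :: "int \<Rightarrow> int \<Rightarrow> complex" where
  "kloosterman u v = (\<Sum>x\<in>U. ep (u * x + v * I x))"

lemma kloosterman_cong:
  assumes "[u = u'] (mod p)" "[v = v'] (mod p)"
  shows "kloosterman u v = kloosterman u' v'"
  unfolding kloosterman_def using assms by (intro sum.cong ep_cong cong_add cong_mult cong_refl refl)

lemma kloosterman_multiple:
  assumes "p dvd u" "p dvd v"
  shows "kloosterman u v = of_int p - 1"
proof -
  have "kloosterman u v = kloosterman 0 0"
    using assms by (intro kloosterman_cong) (auto simp: cong_0_iff)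
  then show ?thesis
    using p_gt_1 by (simp add: kloosterman_def)
qed

text \<open>The substitution x -> c x permutes the units and sends the inverse of x to that of x
  times that of c. One value of the sum thus recurs along a whole orbit of parameters.\<close>

lemma kloosterman_dilate:
  assumes c: "c \<in> U"
  shows "kloosterman (u * c mod p) (v * I c mod p) = kloosterman u v"
proof -
  have "kloosterman u v = (\<Sum>x\<in>U. ep (u * (c * x mod p) + v * I (c * x mod p)))"
    unfolding kloosterman_def
    using sum.reindex_bij_betw[OF bij_betw_int_remainders_mult[OF coprime_U[OF c]],
        of "\<lambda>x. ep (u * x + v * I x)"]
    by simp
  also have "\<dots> = (\<Sum>x\<in>U. ep ((u * c mod p) * x + (v * I c mod p) * I x))"
  proof (intro sum.cong refl ep_cong cong_add)
    fix x assume x: "x \<in> U"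
    show "[u * (c * x mod p) = (u * c mod p) * x] (mod p)"
      by (simp add: Cong.cong_def mod_simps mult.assoc)
    have "I (c * x mod p) = I x * I c mod p"
    proof (rule modular_inverse_int_eqI)
      have "[c * x mod p * (I x * I c mod p) = (c * I c) * (x * I x)] (mod p)"
        unfolding Cong.cong_def mod_mult_eq by (simp only: mult_ac)
      also have "[(c * I c) * (x * I x) = 1 * 1] (mod p)"
        using c x by (intro cong_mult inv_cong)
      finally show "[c * x mod p * (I x * I c mod p) = 1] (mod p)"
        by simp
    qed (use p_gt_1 in auto)
    then show "[v * I (c * x mod p) = (v * I c mod p) * I x] (mod p)"
      by (simp add: Cong.cong_def mod_simps mult_ac)
  qed
  finally show ?thesis
    by (simp add: kloosterman_def)
qed

text \<open>Since 1/a + 1/b = (a + b)/(ab), the two sums determine a + b and ab modulo p, hence the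
  unordered pair, unless a + b = 0 modulo p. In that degenerate case c + d = 0 as well, and a and c
  remain free.\<close>

lemma sum_inv_sum_cases:
  assumes U: "a \<in> U" "b \<in> U" "c \<in> U" "d \<in> U"
    and 1: "p dvd (a + b) - (c + d)"
    and 2: "p dvd (I a + I b) - (I c + I d)"
  shows "(c = a \<and> d = b) \<or> (c = b \<and> d = a) \<or> (b = p - a \<and> d = p - c)"
proof (cases "p dvd a + b")
  case True
  then have "p dvd c + d"
    using 1 dvd_diff_right_iff by blast
  have "y = p - x" if "x \<in> U" "y \<in> U" "p dvd x + y" for x y
  proof (rule U_eqI)
    show "p dvd y - (p - x)"
      using that(3) by (metis add.commute diff_diff_eq2 dvd_add_triv_right_iff dvd_diff_commute
          diff_add_cancel)
  qed (use that in auto)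
  then show ?thesis
    using U True \<open>p dvd c + d\<close> by blast
next
  case False
  have inv: "p dvd x * I x - 1" if "x \<in> U" for x
    using inv_cong[OF that] by (simp add: cong_iff_dvd_diff)
  \<comment> \<open>Clearing denominators: the relation between the inverses is multiplied by abcd,
    and each product of an element with its inverse is replaced by 1.\<close>
  have "p dvd a * b * c * d * ((I a + I b) - (I c + I d))
      - (a * I a - 1) * b * c * d - (b * I b - 1) * a * c * d
      + (c * I c - 1) * a * b * d + (d * I d - 1) * a * b * c"
    by (intro dvd_add dvd_diff dvd_mult2 dvd_mult[OF 2] inv U)
  also have "\<dots> = (a + b) * c * d - a * b * (c + d)"
    by (simp add: algebra_simps)
  finally have 3: "p dvd (a + b) * c * d - a * b * (c + d)" .
  \<comment> \<open>The subtracted multiple of the first relation amounts to substituting d = a + b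
    - c.\<close>
  have "p dvd (a + b) * c * d - a * b * (c + d) - ((a + b) - (c + d)) * (a * b - c * (a + b))"
    by (intro dvd_diff dvd_mult2 1 3)
  also have "\<dots> = - ((a + b) * ((c - a) * (c - b)))"
    by (simp add: algebra_simps)
  finally have "p dvd (c - a) * (c - b)"
    using False prime_p prime_dvd_multD by auto
  then consider "p dvd c - a" | "p dvd c - b"
    using prime_p prime_dvd_multD by blast
  then show ?thesis
  proof cases
    case 1
    then have "c = a"
      using U U_eqI by blast
    with assms have "p dvd b - d"
      by simp
    then show ?thesis
      using \<open>c = a\<close> U U_eqI by blast
  next
    case 2
    then have "c = b"
      using U U_eqI by blast
    with assms have "p dvd a - d"
      by (simp add: algebra_simps)
    then show ?thesis
      using \<open>c = b\<close> U U_eqI by blast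
  qed
qed

text \<open>Each of the three cases of \<open>sum_inv_sum_cases\<close> leaves two free entries, so
  the solutions are covered by three images of U x U.\<close>

lemma card_sum_inv_sum:
  "card {z \<in> (U \<times> U) \<times> (U \<times> U).
     p dvd (fst (fst z) + snd (fst z)) - (fst (snd z) + snd (snd z)) \<and>
     p dvd (I (fst (fst z)) + I (snd (fst z))) - (I (fst (snd z)) + I (snd (snd z)))}
    \<le> 3 * nat (p - 1) ^ 2" (is "card ?Z \<le> _")
proof -
  let ?f = "\<lambda>z::int \<times> int. (z, z)"
  let ?g = "\<lambda>z::int \<times> int. (z, (snd z, fst z))"
  let ?h = "\<lambda>z. ((fst z, p - fst z), (snd z, p - snd z))"
  have le: "card (k ` (U \<times> U)) \<le> nat (p - 1) ^ 2" for k :: "int \<times> int \<Rightarrow> (int \<times> int) \<times> int \<times> int"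
    using card_image_le[of "U \<times> U" k] by (simp add: card_cartesian_product power2_eq_square)
  have "?Z \<subseteq> ?f ` (U \<times> U) \<union> ?g ` (U \<times> U) \<union> ?h ` (U \<times> U)"
  proof
    fix z assume z: "z \<in> ?Z"
    obtain a b c d where z_eq: "z = ((a, b), (c, d))"
      by (metis surj_pair)
    then have "a \<in> U" "b \<in> U" "c \<in> U" "d \<in> U"
      and "p dvd (a + b) - (c + d)" "p dvd (I a + I b) - (I c + I d)"
      using z by auto
    from sum_inv_sum_cases[OF this] show "z \<in> ?f ` (U \<times> U) \<union> ?g ` (U \<times> U) \<union> ?h ` (U \<times> U)"
    proof (elim disjE conjE)
      assume "c = a" "d = b"
      then have "z = ?f (a, b)" by (simp add: z_eq)
      then show ?thesis using \<open>a \<in> U\<close> \<open>b \<in> U\<close> by blast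
    next
      assume "c = b" "d = a"
      then have "z = ?g (a, b)" by (simp add: z_eq)
      then show ?thesis using \<open>a \<in> U\<close> \<open>b \<in> U\<close> by blast
    next
      assume "b = p - a" "d = p - c"
      then have "z = ?h (a, c)" by (simp add: z_eq)
      then show ?thesis using \<open>a \<in> U\<close> \<open>c \<in> U\<close> by blast
    qed
  qed
  then have "card ?Z \<le> card (?f ` (U \<times> U) \<union> ?g ` (U \<times> U) \<union> ?h ` (U \<times> U))"
    by (intro card_mono) auto
  also have "\<dots> \<le> card (?f ` (U \<times> U)) + card (?g ` (U \<times> U)) + card (?h ` (U \<times> U))"
    by (intro order_trans[OF card_Un_le] add_mono card_Un_le order_refl)
  also have "\<dots> \<le> 3 * nat (p - 1) ^ 2"
    using le[of ?f] le[of ?g] le[of ?h] by linarith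
  finally show ?thesis .
qed

text \<open>The fourth power is the squared modulus of the square of the sum, and that square is an
  exponential sum over pairs of units; \<open>parseval\<close> then reduces the moment to
  \<open>card_sum_inv_sum\<close>.\<close>

lemma kloosterman_fourth_moment:
  "(\<Sum>u\<in>{0..<p}. \<Sum>v\<in>{0..<p}. cmod (kloosterman u v) ^ 4) \<le> 3 * of_int p ^ 2 * of_int (p - 1) ^ 2"
proof -
  have "cmod (kloosterman u v) ^ 4 =
      (cmod (\<Sum>t\<in>U \<times> U. ep (u * (fst t + snd t) + v * (I (fst t) + I (snd t)))))\<^sup>2" for u v
  proof -
    have "kloosterman u v ^ 2 = (\<Sum>t\<in>U \<times> U. ep (u * (fst t + snd t) + v * (I (fst t) + I (snd t))))"
      unfolding kloosterman_def power2_eq_square sum_product sum.cartesian_product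
      by (intro sum.cong) (auto simp: ep_add[symmetric] algebra_simps)
    then have "cmod (\<Sum>t\<in>U \<times> U. ep (u * (fst t + snd t) + v * (I (fst t) + I (snd t)))) =
        cmod (kloosterman u v) ^ 2"
      by (metis norm_power)
    then show ?thesis
      by simp
  qed
  then have "(\<Sum>u\<in>{0..<p}. \<Sum>v\<in>{0..<p}. cmod (kloosterman u v) ^ 4) = of_int p ^ 2 * of_nat (card
      {z \<in> (U \<times> U) \<times> (U \<times> U).
       p dvd (fst (fst z) + snd (fst z)) - (fst (snd z) + snd (snd z)) \<and>
       p dvd (I (fst (fst z)) + I (snd (fst z))) - (I (fst (snd z)) + I (snd (snd z)))})"
    by (simp add: parseval)
  also have "\<dots> \<le> of_int p ^ 2 * of_nat (3 * nat (p - 1) ^ 2)"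
    by (intro mult_left_mono of_nat_mono card_sum_inv_sum) auto
  also have "\<dots> = 3 * of_int p ^ 2 * of_int (p - 1) ^ 2"
    using p_gt_1 by simp
  finally show ?thesis .
qed

text \<open>By \<open>kloosterman_dilate\<close> the fourth moment contains this value p - 1 times,
  at the parameters \<open>?d c\<close>. These are distinct because u or v is invertible. Dividing
  by p - 1 turns the bound on the moment into a bound on the single sum.\<close>

lemma norm_kloosterman_power4:
  assumes "\<not> p dvd u \<or> \<not> p dvd v"
  shows "cmod (kloosterman u v) ^ 4 \<le> 3 * of_int p ^ 3"
proof -
  let ?d = "\<lambda>c. (u * c mod p, v * I c mod p)"
  have inj: "inj_on ?d U"
  proof (rule inj_onI)
    fix x y assume xy: "x \<in> U" "y \<in> U" and eq: "?d x = ?d y"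
    have "p dvd u * (x - y)" "p dvd v * (I x - I y)"
      using eq by (auto simp: mod_eq_dvd_iff right_diff_distrib)
    then have "p dvd x - y \<or> p dvd I x - I y"
      using assms prime_p prime_dvd_multD by blast
    then have "x = y \<or> I x = I y"
      using xy U_eqI[of x y] U_eqI[of "I x" "I y"] inv_mem by blast
    then show "x = y"
      using xy inv_inv by metis
  qed
  have "of_int (p - 1) * cmod (kloosterman u v) ^ 4 =
      (\<Sum>c\<in>U. cmod (kloosterman (u * c mod p) (v * I c mod p)) ^ 4)"
    using p_gt_1 by (simp add: kloosterman_dilate)
  also have "\<dots> = (\<Sum>z\<in>?d ` U. cmod (kloosterman (fst z) (snd z)) ^ 4)"
    by (simp add: sum.reindex[OF inj])
  also have "\<dots> \<le> (\<Sum>z\<in>{0..<p} \<times> {0..<p}. cmod (kloosterman (fst z) (snd z)) ^ 4)"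
    using p_gt_1 by (intro sum_mono2) auto
  also have "\<dots> = (\<Sum>u\<in>{0..<p}. \<Sum>v\<in>{0..<p}. cmod (kloosterman u v) ^ 4)"
    by (simp add: sum.cartesian_product case_prod_unfold)
  also have "\<dots> \<le> 3 * of_int p ^ 2 * of_int (p - 1) ^ 2"
    by (rule kloosterman_fourth_moment)
  also have "\<dots> = of_int (p - 1) * (3 * of_int p ^ 2 * of_int (p - 1))"
    by (simp add: power2_eq_square)
  finally have "cmod (kloosterman u v) ^ 4 \<le> 3 * of_int p ^ 2 * of_int (p - 1)"
    using p_gt_1 by (simp add: mult_le_cancel_left_pos)
  also have "\<dots> \<le> 3 * of_int p ^ 2 * of_int p"
    using p_gt_1 by (intro mult_left_mono) auto
  finally show ?thesis
    by (simp add: power2_eq_square power3_eq_cube mult.assoc)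
qed

text \<open>The factor 2 is a convenient upper bound for the fourth root of 3.\<close>

definition kloosterman_bound :: real where
  "kloosterman_bound = 2 * of_int p powr (3 / 4)"

lemma norm_kloosterman_le:
  assumes "\<not> p dvd u \<or> \<not> p dvd v"
  shows "cmod (kloosterman u v) \<le> kloosterman_bound"
proof (rule power_le_imp_le_base)
  have "(of_int p powr (3 / 4)) ^ 4 = (of_int p ^ 3 :: real)"
    using p_gt_1 by (simp add: powr_power powr_numeral)
  then have "kloosterman_bound ^ 4 = 16 * of_int p ^ 3"
    by (simp add: kloosterman_bound_def power_mult_distrib)
  moreover have "(0::real) \<le> of_int p ^ 3"
    using p_gt_1 by simp
  ultimately have "cmod (kloosterman u v) ^ 4 \<le> kloosterman_bound ^ 4"
    using norm_kloosterman_power4[OF assms] by linarith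
  then show "cmod (kloosterman u v) ^ Suc 3 \<le> kloosterman_bound ^ Suc 3"
    by simp
qed (simp add: kloosterman_bound_def)

section \<open>The set Omega' and its first Fourier coefficient\<close>

abbreviation W :: "int set" where
  "W \<equiv> Omega_K' p"

definition X :: "int set" where
  "X = {x \<in> U. x + I x < p}"

lemma W_eq: "W = (\<lambda>x. x + I x) ` X"
  using inv_mem unfolding Omega_K'_def X_def by fastforce

lemma W_subset: "W \<subseteq> {0..<p}"
  using inv_mem by (fastforce simp: W_eq X_def)

lemma finite_W: "finite W"
  using W_subset finite_subset by blast

lemma two_in_W: "2 \<in> W"
proof -
  have "1 \<in> X"
    using p_gt_2 by (simp add: X_def)
  then have "1 + I 1 \<in> W"
    unfolding W_eq by blast
  then show ?thesis
    using p_gt_2 by simp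
qed

text \<open>The map x -> x + I x from X onto W has fibres {x, I x}. These have two elements except
  at x = 1, the only fixed point of inversion in X (p - 1 is excluded by the size condition); the
  added \<open>g 2\<close> compensates for it.\<close>

lemma sum_W:
  fixes g :: "int \<Rightarrow> 'a::comm_ring_1"
  shows "(\<Sum>x\<in>X. g (x + I x)) + g 2 = 2 * (\<Sum>w\<in>W. g w)"
proof -
  let ?X1 = "{x \<in> X. x \<le> I x}" and ?X2 = "{x \<in> X. I x \<le> x}"
  have X_inv: "I x \<in> X" if "x \<in> X" for x
    using that inv_mem[of x] by (auto simp: X_def add.commute)
  have "x = 1" if "x \<in> X" "x = I x" for x
  proof -
    have x: "x \<in> U" "2 * x < p"
      using that by (auto simp: X_def)
    then have "p dvd x * x - 1"
      using inv_cong[of x] that by (simp add: cong_iff_dvd_diff)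
    also have "x * x - 1 = (x - 1) * (x + 1)"
      by (simp add: algebra_simps)
    finally have "p dvd x - 1 \<or> p dvd x + 1"
      using prime_p prime_dvd_multD by blast
    moreover have "\<not> p dvd x + 1"
      using x p_gt_2 by (intro zdvd_not_zless) auto
    ultimately show ?thesis
      using x U_eqI[of x 1] p_gt_2 by auto
  qed
  moreover have "1 \<in> X" "I 1 = 1"
    using p_gt_2 by (auto simp: X_def)
  ultimately have int: "?X1 \<inter> ?X2 = {1}"
    by force
  have un: "?X1 \<union> ?X2 = X"
    by auto
  have fin: "finite X"
    by (rule finite_subset[of _ U]) (auto simp: X_def)
  have "(\<Sum>x\<in>?X2. g (x + I x)) = (\<Sum>x\<in>?X1. g (x + I x))"
    by (rule sum.reindex_bij_witness[of _ I I]) (use X_inv in \<open>auto simp: X_def add.commute\<close>)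
  moreover have "(\<Sum>x\<in>X. g (x + I x)) + g 2 = (\<Sum>x\<in>?X1. g (x + I x)) + (\<Sum>x\<in>?X2. g (x + I x))"
    using sum.union_inter[of ?X1 ?X2 "\<lambda>x. g (x + I x)"] fin un int \<open>I 1 = 1\<close> by simp
  moreover have "(\<Sum>x\<in>?X1. g (x + I x)) = (\<Sum>w\<in>W. g w)"
  proof (rule sum.reindex_bij_betw)
    have "inj_on (\<lambda>x. x + I x) ?X1"
    proof (rule inj_onI)
      fix x y assume xy: "x \<in> ?X1" "y \<in> ?X1" and eq: "x + I x = y + I y"
      then have U: "x \<in> U" "y \<in> U"
        by (auto simp: X_def)
      then have inv: "p dvd x * I x - 1" "p dvd y * I y - 1"
        using inv_cong by (simp_all add: cong_iff_dvd_diff)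
      \<comment> \<open>Eliminating both inverses by means of the equal sums gives (x - y)(xy - 1) =
        0 modulo p, so y is x or its inverse; the ordering condition in \<open>?X1\<close> settles
        the second case.\<close>
      have "p dvd (y * I y - 1) * x - (x * I x - 1) * y"
        by (intro dvd_diff dvd_mult2 inv)
      also have "\<dots> = x * y * (I y - I x) + y - x"
        by (simp add: algebra_simps)
      also have "I y - I x = x - y"
        using eq by simp
      also have "x * y * (x - y) + y - x = (x - y) * (x * y - 1)"
        by (simp add: algebra_simps)
      finally have "p dvd x - y \<or> p dvd x * y - 1"
        using prime_p prime_dvd_multD by blast
      then show "x = y"
      proof
        assume "p dvd x * y - 1"
        then have "I x = y"
          using U by (intro modular_inverse_int_eqI) (auto simp: cong_iff_dvd_diff)
        then show ?thesis
          using xy eq by auto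
      qed (use U U_eqI in blast)
    qed
    moreover have "(\<lambda>x. x + I x) ` ?X1 = W"
    proof
      show "W \<subseteq> (\<lambda>x. x + I x) ` ?X1"
      proof
        fix w assume "w \<in> W"
        then obtain x where x: "x \<in> X" "w = x + I x"
          by (auto simp: W_eq)
        then have "x \<in> U"
          by (simp add: X_def)
        show "w \<in> (\<lambda>x. x + I x) ` ?X1"
        proof (cases "x \<le> I x")
          case False
          then have "I x \<in> ?X1" "w = I x + I (I x)"
            using x X_inv \<open>x \<in> U\<close> by auto
          then show ?thesis
            by blast
        qed (use x in blast)
      qed
    qed (auto simp: W_eq)
    ultimately show "bij_betw (\<lambda>x. x + I x) ?X1 W"
      by (simp add: bij_betw_def)
  qed
  ultimately show ?thesis
    by simp
qed

text \<open>Only the term \<open>k = p - 1\<close> contains a trivial Kloosterman sum; it is the main term.\<close>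

lemma sum_complement_X:
  "(\<Sum>x\<in>U - X. ep (x + I x)) =
    (\<Sum>k\<in>{0..<p}. fcoeff k *
      (kloosterman (k + 1) 1 + kloosterman 1 (k + 1) - kloosterman (k + 1) (k + 1)))"
proof -
  have "(\<Sum>x\<in>U - X. ep (x + I x)) =
      (\<Sum>x\<in>U. (of_int x / of_int p + of_int (I x) / of_int p - of_int ((x + I x) mod p) / of_int p)
        * ep (x + I x))"
  proof (rule sum.mono_neutral_cong_left)
    fix x assume x: "x \<in> U - X"
    then have "(x + I x) mod p = (x + I x - p) mod p"
      by simp
    also have "\<dots> = x + I x - p"
      using x inv_mem[of x] by (intro mod_pos_pos_trivial) (auto simp: X_def)
    finally show "ep (x + I x) =
      (of_int x / of_int p + of_int (I x) / of_int p - of_int ((x + I x) mod p) / of_int p) * ep (x + I x)"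
      using p_gt_1 by (simp add: diff_divide_distrib add_divide_distrib)
  next
    show "\<forall>x\<in>U - (U - X). (of_int x / of_int p + of_int (I x) / of_int p
        - of_int ((x + I x) mod p) / of_int p) * ep (x + I x) = 0"
    proof
      fix x assume x: "x \<in> U - (U - X)"
      then have "(x + I x) mod p = x + I x"
        using inv_mem[of x] by (intro mod_pos_pos_trivial) (auto simp: X_def)
      then show "(of_int x / of_int p + of_int (I x) / of_int p
        - of_int ((x + I x) mod p) / of_int p) * ep (x + I x) = 0"
        by (simp add: add_divide_distrib)
    qed
  qed auto
  also have "\<dots> = (\<Sum>x\<in>U. \<Sum>k\<in>{0..<p}. fcoeff k *
      (ep ((k + 1) * x + 1 * I x) + ep (1 * x + (k + 1) * I x) - ep ((k + 1) * x + (k + 1) * I x)))"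
  \<comment> \<open>The sawtooth is expanded at x, at \<open>I x\<close> and at their sum modulo p;
    the factor \<open>ep (x + I x)\<close> raises the frequency of x and of \<open>I x\<close> by 1,
    whence k + 1 and 1.\<close>
  proof (rule sum.cong[OF refl])
    fix x assume x: "x \<in> U"
    have "of_int x / of_int p = (\<Sum>k\<in>{0..<p}. fcoeff k * ep (k * x))"
      using x by (intro fourier_inversion[symmetric]) auto
    moreover have "of_int (I x) / of_int p = (\<Sum>k\<in>{0..<p}. fcoeff k * ep (k * I x))"
      using inv_mem[OF x] by (intro fourier_inversion[symmetric]) auto
    moreover have "of_int ((x + I x) mod p) / of_int p =
        (\<Sum>k\<in>{0..<p}. fcoeff k * ep (k * (x + I x)))"
      using p_gt_1 fourier_inversion[of "(x + I x) mod p"] by (simp add: ep_mod)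
    ultimately have "(of_int x / of_int p + of_int (I x) / of_int p - of_int ((x + I x) mod p) / of_int p)
        * ep (x + I x) = (\<Sum>k\<in>{0..<p}. fcoeff k *
        (ep (k * x) * ep (x + I x) + ep (k * I x) * ep (x + I x) - ep (k * (x + I x)) * ep (x + I x)))"
      by (simp only: sum.distrib[symmetric] sum_subtractf[symmetric] sum_distrib_right)
        (simp add: algebra_simps)
    then show "(of_int x / of_int p + of_int (I x) / of_int p - of_int ((x + I x) mod p) / of_int p)
        * ep (x + I x) = (\<Sum>k\<in>{0..<p}. fcoeff k *
        (ep ((k + 1) * x + 1 * I x) + ep (1 * x + (k + 1) * I x) - ep ((k + 1) * x + (k + 1) * I x)))"
      unfolding ep_add[symmetric] by (simp add: algebra_simps)
  qed
  also have "\<dots> = (\<Sum>k\<in>{0..<p}. fcoeff k *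
      (kloosterman (k + 1) 1 + kloosterman 1 (k + 1) - kloosterman (k + 1) (k + 1)))"
    unfolding kloosterman_def
    by (subst sum.swap) (simp add: sum_distrib_left[symmetric] sum.distrib sum_subtractf)
  finally show ?thesis .
qed

lemma norm_sum_X:
  "cmod ((\<Sum>x\<in>X. ep (x + I x)) - fcoeff (p - 1) * (of_int p - 1))
    \<le> kloosterman_bound * (10 + 6 * ln (of_int p))"
proof -
  define G where "G k = kloosterman (k + 1) 1 + kloosterman 1 (k + 1) - kloosterman (k + 1) (k + 1)" for k
  \<comment> \<open>At k = p - 1 the subtracted Kloosterman sum in G is trivial, with value p - 1.
    Adding it back leaves only sums obeying \<open>kloosterman_bound\<close>.\<close>
  define G' where "G' k = G k + (if k = p - 1 then of_int p - 1 else 0)" for k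
  have bound_nonneg: "kloosterman_bound \<ge> 0"
    by (simp add: kloosterman_bound_def)
  have not_dvd_1: "\<not> p dvd 1"
    using p_gt_1 by (simp add: zdvd_not_zless)
  have G': "cmod (G' k) \<le> 3 * kloosterman_bound" if k: "k \<in> {0..<p}" for k
  proof -
    define Y where "Y = (if k = p - 1 then 0 else kloosterman (k + 1) (k + 1))"
    have "cmod Y \<le> kloosterman_bound"
    proof (cases "k = p - 1")
      case False
      then have "\<not> p dvd k + 1"
        using k by (intro zdvd_not_zless) auto
      then show ?thesis
        using False norm_kloosterman_le by (simp add: Y_def)
    qed (simp add: Y_def bound_nonneg)
    moreover have "G' k = kloosterman (k + 1) 1 + kloosterman 1 (k + 1) - Y"
      using kloosterman_multiple[of p p] by (auto simp: G'_def G_def Y_def)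
    moreover have "cmod (kloosterman (k + 1) 1) \<le> kloosterman_bound"
      "cmod (kloosterman 1 (k + 1)) \<le> kloosterman_bound"
      using not_dvd_1 by (auto intro: norm_kloosterman_le)
    ultimately show ?thesis
      using norm_triangle_ineq4[of "kloosterman (k + 1) 1 + kloosterman 1 (k + 1)" Y]
        norm_triangle_ineq[of "kloosterman (k + 1) 1" "kloosterman 1 (k + 1)"] by simp
  qed
  have "(\<Sum>x\<in>X. ep (x + I x)) = kloosterman 1 1 - (\<Sum>x\<in>U - X. ep (x + I x))"
  proof -
    have "X \<subseteq> U"
      by (auto simp: X_def)
    then show ?thesis
      using sum.subset_diff[of X U "\<lambda>x. ep (x + I x)"] by (simp add: kloosterman_def)
  qed
  also have "(\<Sum>x\<in>U - X. ep (x + I x)) =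
      (\<Sum>k\<in>{0..<p}. fcoeff k * G' k) - fcoeff (p - 1) * (of_int p - 1)"
  proof -
    have "(\<Sum>k\<in>{0..<p}. fcoeff k * G' k) = (\<Sum>k\<in>{0..<p}. fcoeff k * G k) +
        (\<Sum>k\<in>{0..<p}. if k = p - 1 then fcoeff (p - 1) * (of_int p - 1) else 0)"
      unfolding sum.distrib[symmetric] by (intro sum.cong) (auto simp: G'_def ring_distribs)
    then show ?thesis
      using p_gt_1 by (simp add: sum_complement_X G_def)
  qed
  finally have "cmod ((\<Sum>x\<in>X. ep (x + I x)) - fcoeff (p - 1) * (of_int p - 1)) =
      cmod (kloosterman 1 1 - (\<Sum>k\<in>{0..<p}. fcoeff k * G' k))"
    by simp
  also have "\<dots> \<le> cmod (kloosterman 1 1) + cmod (\<Sum>k\<in>{0..<p}. fcoeff k * G' k)"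
    by (rule norm_triangle_ineq4)
  \<comment> \<open>With \<open>sum_norm_fcoeff\<close> the total factor becomes 1 + 3 (3 + 2 ln p)
    = 10 + 6 ln p.\<close>
  also have "\<dots> \<le> kloosterman_bound + (\<Sum>k\<in>{0..<p}. cmod (fcoeff k) * (3 * kloosterman_bound))"
    using not_dvd_1 G' by (intro add_mono norm_kloosterman_le sum_norm_le)
      (auto simp: norm_mult mult_left_mono)
  also have "(\<Sum>k\<in>{0..<p}. cmod (fcoeff k) * (3 * kloosterman_bound))
      \<le> (3 + 2 * ln (of_int p)) * (3 * kloosterman_bound)"
    unfolding sum_distrib_right[symmetric] using bound_nonneg
    by (intro mult_right_mono sum_norm_fcoeff) auto
  finally show ?thesis
    by (simp add: algebra_simps)
qed

text \<open>The 7 is an upper bound for 2 pi from \<open>norm_fcoeff_last\<close>; the final 1 pays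
  for the term \<open>ep 2\<close> that \<open>sum_W\<close> adds.\<close>

lemma norm_sum_W:
  "2 * cmod (\<Sum>w\<in>W. ep w) \<ge> (of_int p - 1) / 7 - kloosterman_bound * (10 + 6 * ln (of_int p)) - 1"
proof -
  let ?T = "\<Sum>x\<in>X. ep (x + I x)" and ?M = "fcoeff (p - 1) * (of_int p - 1)"
  have "1 / 7 \<le> 1 / (2 * pi)"
    using pi_approx by (intro frac_le) auto
  then have "1 / 7 \<le> cmod (fcoeff (p - 1))"
    using norm_fcoeff_last by linarith
  then have "1 / 7 * (of_int p - 1) \<le> cmod (fcoeff (p - 1)) * (of_int p - 1)"
    using p_gt_1 by (intro mult_right_mono) auto
  also have "\<dots> = cmod ?M"
    using p_gt_1 norm_of_int[of "p - 1", where 'a = complex] by (simp add: norm_mult)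
  also have "\<dots> \<le> cmod ?T + cmod (?T - ?M)"
    by (metis norm_minus_commute norm_triangle_sub)
  also have "cmod ?T \<le> cmod (?T + ep 2) + 1"
    using norm_triangle_ineq4[of "?T + ep 2" "ep 2"] by simp
  also have "cmod (?T + ep 2) = 2 * cmod (\<Sum>w\<in>W. ep w)"
    unfolding sum_W by (simp add: norm_mult)
  finally show ?thesis
    using norm_sum_X by linarith
qed

section \<open>Fourier coefficients of the deviation and lower bounds for the variance\<close>

definition deviation :: "int \<Rightarrow> int \<Rightarrow> real" where
  "deviation h n = (\<Sum>m\<in>{m \<in> {n..n + h}. m mod p \<in> W}. 1) - of_int h / of_int p * of_nat (card W)"

text \<open>Up to a constant, the deviation correlates the indicator of W with that of {0..h}, so
  its Fourier coefficients factor. The constant is visible only at frequencies divisible by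
  p.\<close>

lemma sum_deviation_twisted:
  assumes "0 \<le> h"
  shows "(\<Sum>n\<in>{0..<p}. of_real (deviation h n) * ep (- (u * n))) =
    (\<Sum>j\<in>{0..<h + 1}. ep (u * j)) * (\<Sum>w\<in>W. ep (- (u * w)))
      - of_int h * of_nat (card W) * (if p dvd u then 1 else 0)"
proof -
  let ?c = "complex_of_int h / of_int p * of_nat (card W)"
  have dev: "of_real (deviation h n) = (\<Sum>j\<in>{0..<h + 1}. if (n + j) mod p \<in> W then 1 else 0) - ?c" for n
  proof -
    have "(\<Sum>m\<in>{m \<in> {n..n + h}. m mod p \<in> W}. 1 :: complex) =
        (\<Sum>m\<in>{n..n + h}. if m mod p \<in> W then 1 else 0)"
      by (rule sum.inter_filter) simp
    also have "\<dots> = (\<Sum>j\<in>{0..<h + 1}. if (n + j) mod p \<in> W then 1 else 0)"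
      by (rule sum.reindex_bij_witness[of _ "\<lambda>j. n + j" "\<lambda>m. m - n"]) auto
    finally show ?thesis
      by (simp add: deviation_def)
  qed
  have shift: "(\<Sum>n\<in>{0..<p}. (if (n + j) mod p \<in> W then 1 else 0) * ep (- (u * n))) =
      ep (u * j) * (\<Sum>w\<in>W. ep (- (u * w)))" for j
  proof -
    have "ep (- (u * n)) = ep (u * j) * ep (- u * ((n + j) mod p))" for n
      unfolding ep_mod ep_add[symmetric] by (simp add: algebra_simps)
    then have "(\<Sum>n\<in>{0..<p}. (if (n + j) mod p \<in> W then 1 else 0) * ep (- (u * n))) =
        ep (u * j) * (\<Sum>n\<in>{0..<p}. (if (n + j) mod p \<in> W then 1 else 0) * ep (- u * ((n + j) mod p)))"
      by (simp add: sum_distrib_left mult_ac)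
    also have "(\<Sum>n\<in>{0..<p}. (if (n + j) mod p \<in> W then 1 else 0) * ep (- u * ((n + j) mod p))) =
        (\<Sum>m\<in>{0..<p}. (if m \<in> W then 1 else 0) * ep (- u * m))"
      by (rule sum.reindex_bij_betw[OF bij_betw_shift_mod])
    also have "\<dots> = (\<Sum>w\<in>W. ep (- (u * w)))"
      using W_subset by (intro sum.mono_neutral_cong_right) auto
    finally show ?thesis .
  qed
  have "(\<Sum>n\<in>{0..<p}. of_real (deviation h n) * ep (- (u * n))) =
      (\<Sum>n\<in>{0..<p}. \<Sum>j\<in>{0..<h + 1}. (if (n + j) mod p \<in> W then 1 else 0) * ep (- (u * n)))
      - ?c * (\<Sum>n\<in>{0..<p}. ep (- u * n))"
    unfolding dev by (simp only: left_diff_distrib sum_subtractf sum_distrib_left sum_distrib_right) simp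
  also have "(\<Sum>n\<in>{0..<p}. \<Sum>j\<in>{0..<h + 1}. (if (n + j) mod p \<in> W then 1 else 0) * ep (- (u * n))) =
      (\<Sum>j\<in>{0..<h + 1}. ep (u * j)) * (\<Sum>w\<in>W. ep (- (u * w)))"
    by (subst sum.swap) (simp only: shift sum_distrib_right)
  finally show ?thesis
    unfolding sum_ep using p_gt_1 by simp
qed

lemma norm_sum_deviation_le:
  "(cmod (\<Sum>n\<in>{0..<p}. of_real (deviation h n) * ep (- (u * n))))\<^sup>2
    \<le> of_int p * (\<Sum>n\<in>{0..<p}. (deviation h n)\<^sup>2)"
proof -
  have "(cmod (\<Sum>n\<in>{0..<p}. of_real (deviation h n) * ep (- (u * n))))\<^sup>2
      \<le> (\<Sum>n\<in>{0..<p}. \<bar>deviation h n\<bar>)\<^sup>2"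
    by (intro power_mono sum_norm_le) (auto simp: norm_mult)
  also have "\<dots> \<le> (\<Sum>n\<in>{0..<p}. \<bar>deviation h n\<bar>\<^sup>2) * card {0..<p}"
    by (rule sum_squared_le_sum_of_squares)
  finally show ?thesis
    using p_gt_1 by (simp add: mult.commute)
qed

lemma sum_deviation_ge_trivial:
  assumes "0 \<le> h"
  shows "of_int p * (\<Sum>n\<in>{0..<p}. (deviation h n)\<^sup>2) \<ge> 1"
proof -
  have "card W \<ge> 1"
    using two_in_W finite_W by (metis One_nat_def Suc_leI card_gt_0_iff empty_iff)
  have "1 \<le> (real (card W))\<^sup>2"
    using \<open>card W \<ge> 1\<close> by simp
  \<comment> \<open>At frequency 0 the h + 1 shifts exceed the h subtracted copies of
    \<open>card W\<close> by exactly one.\<close>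
  also have "complex_of_nat (card W) = (\<Sum>n\<in>{0..<p}. of_real (deviation h n) * ep (- (0 * n)))"
    unfolding sum_deviation_twisted[OF assms] using assms by (simp add: algebra_simps)
  then have "real (card W) = cmod (\<Sum>n\<in>{0..<p}. of_real (deviation h n) * ep (- (0 * n)))"
    by (metis norm_of_nat)
  also have "\<dots>\<^sup>2 \<le> of_int p * (\<Sum>n\<in>{0..<p}. (deviation h n)\<^sup>2)"
    by (rule norm_sum_deviation_le)
  finally show ?thesis .
qed

lemma sum_deviation_ge:
  assumes "0 \<le> h" "2 * h < p"
  shows "of_int p * (\<Sum>n\<in>{0..<p}. (deviation h n)\<^sup>2)
    \<ge> (of_int h / (2 * pi) * cmod (\<Sum>w\<in>W. ep w))\<^sup>2"
proof -
  have "\<not> p dvd 1"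
    using p_gt_1 by (simp add: zdvd_not_zless)
  then have eq: "(\<Sum>n\<in>{0..<p}. of_real (deviation h n) * ep (- (1 * n))) =
      (\<Sum>j\<in>{0..<h + 1}. ep j) * cnj (\<Sum>w\<in>W. ep w)"
    unfolding sum_deviation_twisted[OF assms(1)] by (simp add: ep_minus)
  have "of_int h / (2 * pi) \<le> of_int (h + 1) / (2 * pi)"
    by (intro divide_right_mono) auto
  \<comment> \<open>As p is odd, 2h < p gives 2 (h + 1) <= p + 1, and p >= 3 turns this into 3 (h +
    1) <= 2p.\<close>
  also have "\<dots> \<le> cmod (\<Sum>j\<in>{0..<h + 1}. ep j)"
    using assms p_gt_2 odd_p by (intro norm_sum_ep) auto
  finally have "of_int h / (2 * pi) * cmod (\<Sum>w\<in>W. ep w) \<le>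
      cmod (\<Sum>j\<in>{0..<h + 1}. ep j) * cmod (\<Sum>w\<in>W. ep w)"
    by (intro mult_right_mono) auto
  also have "\<dots> = cmod (\<Sum>n\<in>{0..<p}. of_real (deviation h n) * ep (- (1 * n)))"
    unfolding eq by (simp only: norm_mult complex_mod_cnj)
  finally have "(of_int h / (2 * pi) * cmod (\<Sum>w\<in>W. ep w))\<^sup>2 \<le>
      (cmod (\<Sum>n\<in>{0..<p}. of_real (deviation h n) * ep (- (1 * n))))\<^sup>2"
    using assms by (intro power_mono) auto
  also have "\<dots> \<le> of_int p * (\<Sum>n\<in>{0..<p}. (deviation h n)\<^sup>2)"
    by (rule norm_sum_deviation_le)
  finally show ?thesis .
qed

lemma variance_eq: "(1 / real_of_int p) * (\<Sum>n\<in>{0..p - 1}. (deviation h n)\<^sup>2) * (of_int p)\<^sup>2 =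
    of_int p * (\<Sum>n\<in>{0..<p}. (deviation h n)\<^sup>2)"
proof -
  have "{0..p - 1} = {0..<p}"
    by auto
  then show ?thesis
    using p_gt_1 by (simp add: power2_eq_square)
qed

lemma variance_ge_trivial:
  assumes "0 \<le> h"
  shows "(1 / real_of_int p) * (\<Sum>n\<in>{0..p - 1}. (deviation h n)\<^sup>2) \<ge> 1 / (of_int p)\<^sup>2"
  using sum_deviation_ge_trivial[OF assms] p_gt_1 unfolding variance_eq[symmetric]
  by (simp add: divide_le_eq)

text \<open>The assumption on p says that the error terms use up at most the gap between (p - 1)/7
  and p/8. Half of p/8 then bounds the coefficient of W, and 1/(2 pi) times 1/16 gives 1/(32
  pi).\<close>

lemma variance_ge:
  assumes h: "0 \<le> h" "2 * h < p"
    and p: "(of_int p - 1) / 7 - 2 * of_int p powr (3 / 4) * (10 + 6 * ln (of_int p)) - 1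
      \<ge> real_of_int p / 8"
  shows "(1 / real_of_int p) * (\<Sum>n\<in>{0..p - 1}. (deviation h n)\<^sup>2) \<ge> (1 / (32 * pi))\<^sup>2 * (of_int h)\<^sup>2"
proof -
  have "of_int p / 8 \<le> 2 * cmod (\<Sum>w\<in>W. ep w)"
    using p norm_sum_W unfolding kloosterman_bound_def by linarith
  then have "of_int h / (2 * pi) * (of_int p / 16) \<le> of_int h / (2 * pi) * cmod (\<Sum>w\<in>W. ep w)"
    using h by (intro mult_left_mono) auto
  then have "(of_int h / (2 * pi) * (of_int p / 16))\<^sup>2 \<le> (of_int h / (2 * pi) * cmod (\<Sum>w\<in>W. ep w))\<^sup>2"
    using h p_gt_1 by (intro power_mono) auto
  also have "\<dots> \<le> of_int p * (\<Sum>n\<in>{0..<p}. (deviation h n)\<^sup>2)"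
    by (intro sum_deviation_ge h)
  also have "(of_int h / (2 * pi) * (of_int p / 16))\<^sup>2 = (1 / (32 * pi))\<^sup>2 * (of_int h)\<^sup>2 * (of_int p)\<^sup>2"
    by (simp add: power_mult_distrib power_divide)
  finally have "(1 / (32 * pi))\<^sup>2 * (of_int h)\<^sup>2 * (of_int p)\<^sup>2 \<le>
      (1 / real_of_int p) * (\<Sum>n\<in>{0..p - 1}. (deviation h n)\<^sup>2) * (of_int p)\<^sup>2"
    unfolding variance_eq .
  moreover have "(0::real) < (of_int p)\<^sup>2"
    using p_gt_1 by simp
  ultimately show ?thesis
    by (rule mult_right_le_imp_le)
qed

end

section \<open>Choice of the absolute constant\<close>

theorem theorem1p4:
  shows "\<exists>c::real. c > 0 \<and>
    (\<forall>p::int. prime p \<and> odd p \<longrightarrow>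
      (\<forall>h::int. 0 < h \<and> real_of_int h < real_of_int p / 2 \<longrightarrow>
        (1 / real_of_int p) *
          (\<Sum>n\<in>{0..p - 1}.
             ((\<Sum>m\<in>{m \<in> {n..n + h}. m mod p \<in> Omega_K' p}. 1)
               - (real_of_int h / real_of_int p) * real (card (Omega_K' p)))\<^sup>2)
        \<ge> c * (real_of_int h)\<^sup>2))"
proof -
  \<comment> \<open>The error of order x^(3/4) ln x is eventually smaller than the linear gain (1/7
    - 1/8) x.\<close>
  have "eventually (\<lambda>x::real. (x - 1) / 7 - 2 * x powr (3 / 4) * (10 + 6 * ln x) - 1 \<ge> x / 8) at_top"
    by real_asymp
  then obtain N :: real where N: "\<And>x. x \<ge> N \<Longrightarrow> (x - 1) / 7 - 2 * x powr (3 / 4) * (10 + 6 * ln x) - 1 \<ge> x / 8"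
    unfolding eventually_at_top_linorder by blast
  define M where "M = max N 1"
  \<comment> \<open>The second entry serves p < M: there h and p are both below M, so c h^2 p^2 <= 1
    and the trivial bound 1/p^2 suffices.\<close>
  define c where "c = min ((1 / (32 * pi))\<^sup>2) (1 / M ^ 4)"
  have "M \<ge> 1"
    by (simp add: M_def)
  have "c > 0"
    using \<open>M \<ge> 1\<close> by (simp add: c_def)
  moreover have "c * (real_of_int h)\<^sup>2 \<le> (1 / real_of_int p) * (\<Sum>n\<in>{0..p - 1}.
      ((\<Sum>m\<in>{m \<in> {n..n + h}. m mod p \<in> Omega_K' p}. 1)
        - (real_of_int h / real_of_int p) * real (card (Omega_K' p)))\<^sup>2)" (is "_ \<le> ?V")
    if p: "prime p" "odd p" and h: "0 < h" "real_of_int h < real_of_int p / 2" for p h :: int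
  proof -
    have loc: "odd_prime_modulus p"
      using p prime_gt_1_int by unfold_locales auto
    have hp: "2 * h < p"
      using h by linarith
    have p0: "real_of_int p > 0"
      using h by linarith
    show ?thesis
    proof (cases "real_of_int p \<ge> M")
      case True
      have "c * (real_of_int h)\<^sup>2 \<le> (1 / (32 * pi))\<^sup>2 * (of_int h)\<^sup>2"
        by (intro mult_right_mono) (auto simp: c_def)
      also have "\<dots> \<le> ?V"
        using odd_prime_modulus.variance_ge[OF loc _ hp N] h True
        unfolding odd_prime_modulus.deviation_def[OF loc] by (simp add: M_def)
      finally show ?thesis .
    next
      case False
      have "c * (real_of_int h)\<^sup>2 * (of_int p)\<^sup>2 \<le> 1 / M ^ 4 * M\<^sup>2 * M\<^sup>2"
        using False h p0 \<open>c > 0\<close> \<open>M \<ge> 1\<close> by (intro mult_mono power_mono) (auto simp: c_def)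
      also have "\<dots> = 1"
        using \<open>M \<ge> 1\<close> by (simp flip: power_add)
      finally have "c * (real_of_int h)\<^sup>2 \<le> 1 / (of_int p)\<^sup>2"
        using p0 by (simp add: le_divide_eq)
      also have "\<dots> \<le> ?V"
        using odd_prime_modulus.variance_ge_trivial[OF loc, of h] h
        unfolding odd_prime_modulus.deviation_def[OF loc] by simp
      finally show ?thesis .
    qed
  qed
  ultimately show ?thesis
    by blast
qed

end
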